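(* For integers $n\ge 1$ let $L_3(n)=2^{2n}-2^n+1$. Let $m\ge 0$, $m_1\ge 0$, $m_2\ge 0$, $n>0$, $n_1>0$, $n_2>0$ be integers and let $t_1\ge 1$, $t_2\ge 1$ be odd integers with $t_1\not\equiv 0\pmod 3$ and $t_2\not\equiv 0\pmod 3$. Then: (1) $\gcd\bigl(L_3(3^m2^nt_1),L_3(3^m2^nt_2)\bigr)=L_3\bigl(3^m2^n\gcd(t_1,t_2)\bigr)$; (2) if $m_1\ne m_2$ or $n_1\ne n_2$, then $\gcd\bigl(L_3(3^{m_1}2^{n_1}t_1),L_3(3^{m_2}2^{n_2}t_2)\bigr)=1$.
   Context: $\gcd(a,b)$ denotes the (positive) greatest common divisor of positive integers $a,b$. *)

theory Defs
  imports "HOL-Number_Theory.Number_Theory"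
begin

(* Integer-valued, so that the subtraction is not truncated. *)
definition L3 :: "nat \<Rightarrow> int" where
  "L3 n = 2 ^ (2 * n) - 2 ^ n + 1"

end

theory Submission
  imports Defs
begin

text \<open>
  Put \<open>x = 2 ^ N\<close>, so that \<open>L3 N = x\<^sup>2 - x + 1\<close> divides \<open>x ^ 3 + 1\<close>. A common divisor \<open>D\<close> of
  \<open>L3 a\<close> and \<open>L3 b\<close> therefore divides \<open>2 ^ (6 * gcd a b) - 1\<close>.

  For (1), let \<open>y = 2 ^ gcd a b\<close>. Then \<open>y ^ 6 = 1\<close> modulo \<open>D\<close>, so a power of \<open>y\<close> with exponent
  coprime to 6 is \<open>y\<close> or the inverse of \<open>y\<close>; the polynomial \<open>X\<^sup>2 - X + 1\<close> is palindromic and hence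
  vanishes modulo \<open>D\<close> at all these powers or at none.

  For (2), some \<open>p \<in> {2, 3}\<close> divides, say, \<open>b div gcd a b\<close>, so with \<open>x = 2 ^ b\<close> also
  \<open>x ^ (6 div p) = 1\<close> modulo \<open>D\<close>. Together with \<open>x ^ 3 = -1\<close> this gives \<open>D dvd 2\<close> or \<open>D dvd 3\<close>,
  whereas \<open>L3 b\<close> is coprime to 6 for even \<open>b > 0\<close>.
\<close>

text \<open>Bezout in the form \<open>a * u = b * v + gcd a b\<close> keeps every exponent natural,
  so no inverse of \<open>x\<close> modulo \<open>D\<close> has to be chosen.\<close>

lemma cong_power_gcd_eq_1:
  fixes x D :: int
  assumes "[x ^ a = 1] (mod D)" "[x ^ b = 1] (mod D)"
  shows "[x ^ gcd a b = 1] (mod D)"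
proof (cases "a = 0")
  case False
  then obtain u v where uv: "a * u = b * v + gcd a b"
    using bezout_nat by blast
  have "[x ^ (a * u) = 1] (mod D)" "[x ^ (b * v) = 1] (mod D)"
    using cong_pow[OF assms(1), of u] cong_pow[OF assms(2), of v] by (simp_all add: power_mult)
  then have "[1 = x ^ (b * v) * x ^ gcd a b] (mod D)" "[x ^ (b * v) * x ^ gcd a b = 1 * x ^ gcd a b] (mod D)"
    by (simp_all add: uv power_add cong_sym cong_scalar_right del: mult_1)
  then show ?thesis
    by (metis cong_sym cong_trans mult_1)
qed (use assms in simp)

lemma cong_power_eq_1_dvd:
  fixes x D :: int
  assumes "[x ^ a = 1] (mod D)" "a dvd b"
  shows "[x ^ b = 1] (mod D)"
  using assms cong_pow[of "x ^ a" 1 D] by (auto simp: power_mult elim!: dvdE)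

lemma L3_mult: "L3 (k * a) = ((2 ^ k) ^ a)\<^sup>2 - (2 ^ k) ^ a + 1"
  by (simp add: L3_def power_mult [symmetric] ac_simps)

lemma L3_eq: "L3 k = (2 ^ k)\<^sup>2 - 2 ^ k + 1"
  using L3_mult [of k 1] by simp

lemma L3_dvd_power_plus_1: "L3 k dvd 2 ^ (3 * k) + 1"
proof -
  have "2 ^ (3 * k) + 1 = L3 k * (2 ^ k + 1)"
    unfolding L3_eq power_mult mult.commute [of 3 k]
    by (simp add: algebra_simps power2_eq_square power3_eq_cube)
  then show ?thesis by simp
qed

lemma L3_cong_power_6:
  assumes "D dvd L3 k"
  shows "[2 ^ (6 * k) = 1] (mod D)"
proof -
  have "(2 :: int) ^ (6 * k) - 1 = (2 ^ (3 * k) + 1) * (2 ^ (3 * k) - 1)"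
    by (simp add: algebra_simps flip: power_add)
  moreover have "D dvd 2 ^ (3 * k) + 1"
    using assms L3_dvd_power_plus_1 dvd_trans by blast
  ultimately show ?thesis
    by (simp add: cong_iff_dvd_diff)
qed

lemma L3_cong_power_6_gcd:
  assumes "D dvd L3 a" "D dvd L3 b"
  shows "[2 ^ (6 * gcd a b) = 1] (mod D)"
  using cong_power_gcd_eq_1 [OF L3_cong_power_6 [OF assms(1)] L3_cong_power_6 [OF assms(2)]]
  by (simp only: gcd_mult_distrib_nat)

lemma quadratic_dvd_power_iff:
  fixes y D :: int
  assumes "[y ^ 6 = 1] (mod D)" "coprime a (6 :: nat)"
  shows "D dvd (y ^ a)\<^sup>2 - y ^ a + 1 \<longleftrightarrow> D dvd y\<^sup>2 - y + 1"
proof -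
  have reduce: "[y ^ a = y ^ (a mod 6)] (mod D)"
  proof -
    have "[(y ^ 6) ^ (a div 6) * y ^ (a mod 6) = 1 ^ (a div 6) * y ^ (a mod 6)] (mod D)"
      using assms(1) by (intro cong_mult cong_pow cong_refl)
    then show ?thesis by (simp flip: power_mult power_add)
  qed
  then have "[(y ^ a)\<^sup>2 - y ^ a + 1 = (y ^ (a mod 6))\<^sup>2 - y ^ (a mod 6) + 1] (mod D)"
    by (intro cong_add cong_diff cong_pow cong_refl)
  then have iff: "D dvd (y ^ a)\<^sup>2 - y ^ a + 1 \<longleftrightarrow> D dvd (y ^ (a mod 6))\<^sup>2 - y ^ (a mod 6) + 1"
    by (rule cong_dvd_iff)
  have "\<not> 2 dvd a" "\<not> 3 dvd a"
    using assms(2) coprime_common_divisor [of a 6 2] coprime_common_divisor [of a 6 3] by auto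
  then have "a mod 6 = 1 \<or> a mod 6 = 5"
    by presburger
  then show ?thesis
  proof
    assume "a mod 6 = 5"
    have y6: "D dvd y ^ 6 - 1"
      using assms(1) by (simp add: cong_iff_dvd_diff)
    \<comment> \<open>Modulo \<open>y ^ 6 - 1\<close>, the values at \<open>y\<close> and \<open>y ^ 5\<close> differ by a unit factor, \<open>y\<^sup>2\<close>.\<close>
    have "y\<^sup>2 * ((y ^ 5)\<^sup>2 - y ^ 5 + 1) = (y\<^sup>2 - y + 1) + (y ^ 6 - 1) * (y ^ 6 + 1 - y)"
         "(y ^ 5)\<^sup>2 - y ^ 5 + 1 = y ^ 4 * (y\<^sup>2 - y + 1) + (y ^ 6 - 1) * (y ^ 4 - 1)"
      by (simp_all add: algebra_simps flip: power_mult power_add power_Suc)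
    then have "D dvd (y ^ 5)\<^sup>2 - y ^ 5 + 1 \<longleftrightarrow> D dvd y\<^sup>2 - y + 1"
      using y6 by (metis dvd_add_left_iff dvd_mult dvd_mult2)
    with \<open>a mod 6 = 5\<close> iff show ?thesis by simp
  qed (use iff in simp)
qed

text \<open>Mutual divisibility fixes an integer only up to sign; positivity settles the sign in
  \<open>gcd_L3_mult\<close>.\<close>

lemma L3_pos: "L3 k > 0"
proof -
  have "(2 :: int) ^ k * 1 \<le> 2 ^ k * 2 ^ k"
    by (intro mult_left_mono) auto
  then show ?thesis by (simp add: L3_eq power2_eq_square)
qed

lemma gcd_L3_mult:
  assumes "coprime a 6" "coprime b 6"
  shows "gcd (L3 (k * a)) (L3 (k * b)) = L3 (k * gcd a b)"
proof -
  define g where "g = gcd a b"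
  obtain a' b' where ab: "a = g * a'" "b = g * b'"
    unfolding g_def by (meson gcd_dvd1 gcd_dvd2 dvdE)
  have cop: "coprime a' 6" "coprime b' 6"
    using assms ab by simp_all
  have split: "L3 (k * a) = L3 (k * g * a')" "L3 (k * b) = L3 (k * g * b')"
    by (simp_all add: ab ac_simps)
  have "gcd (k * a) (k * b) = k * g"
    by (simp add: g_def gcd_mult_distrib_nat)
  \<comment> \<open>Applied to two moduli below: to \<open>L3 (k * g)\<close> itself for one
    divisibility, and to the gcd of the two values for the other.\<close>
  then have iff: "D dvd L3 (k * g * c) \<longleftrightarrow> D dvd L3 (k * g)"
    if "[(2 :: int) ^ (6 * (k * g)) = 1] (mod D)" "coprime c 6" for D c
    using that quadratic_dvd_power_iff [of "2 ^ (k * g)" D c]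
    by (simp only: L3_mult [of "k * g" c] L3_eq [of "k * g"] flip: power_mult) (simp add: ac_simps)
  have "L3 (k * g) dvd gcd (L3 (k * a)) (L3 (k * b))"
    using iff [OF L3_cong_power_6 [OF dvd_refl]] cop by (simp add: split)
  moreover have "gcd (L3 (k * a)) (L3 (k * b)) dvd L3 (k * g)"
  proof -
    let ?D = "gcd (L3 (k * a)) (L3 (k * b))"
    have "[2 ^ (6 * (k * g)) = 1] (mod ?D)"
      using L3_cong_power_6_gcd [of ?D "k * a" "k * b"] \<open>gcd (k * a) (k * b) = k * g\<close> by simp
    moreover have "?D dvd L3 (k * g * a')"
      by (simp add: split)
    ultimately show ?thesis
      using iff cop(1) by blast
  qed
  ultimately show ?thesis
    using L3_pos [of "k * g"] unfolding g_def [symmetric]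
    by (intro zdvd_antisym_nonneg) auto
qed

text \<open>If \<open>p\<close> did not divide the cofactor of the gcd in \<open>b\<close>, all of
  \<open>p ^ e\<close> would lie in the gcd and hence divide \<open>a\<close>.\<close>

lemma prime_mult_gcd_dvd:
  fixes a b p :: nat
  assumes "prime p" "p ^ e dvd b" "\<not> p ^ e dvd a"
  shows "p * gcd a b dvd b"
proof -
  obtain c where c: "b = gcd a b * c"
    using gcd_dvd2 by blast
  have "p dvd c"
  proof (rule ccontr)
    assume "\<not> p dvd c"
    then have "coprime (p ^ e) c"
      using assms(1) prime_imp_coprime by auto
    then have "p ^ e dvd gcd a b"
      using assms(2) c by (metis coprime_dvd_mult_left_iff)
    then show False
      using assms(3) by auto
  qed
  then show ?thesis
    using c by (metis dvd_refl mult.commute mult_dvd_mono)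
qed

lemma odd_L3: "k > 0 \<Longrightarrow> odd (L3 k)"
  by (simp add: L3_eq)

text \<open>Powers of 4 are 1 modulo 3. For odd \<open>k\<close> the power of 2 would be 2, which is
  a root of X^2 - X + 1 modulo 3.\<close>

lemma not_3_dvd_L3:
  assumes "even k"
  shows "\<not> 3 dvd L3 k"
proof -
  obtain j where "k = 2 * j"
    using assms by blast
  moreover have "[(4 :: int) ^ j = 1 ^ j] (mod 3)"
    by (intro cong_pow) (simp add: cong_def)
  ultimately have "[2 ^ k = (1 :: int)] (mod 3)"
    by (simp add: power_mult)
  then have "[L3 k = 1\<^sup>2 - 1 + 1] (mod 3)"
    unfolding L3_eq by (intro cong_add cong_diff cong_pow cong_refl)
  then show ?thesis
    by (auto simp: cong_dvd_iff)
qed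

text \<open>The power \<open>p ^ e\<close> witnesses that \<open>b\<close> has a larger
  \<open>p\<close>-adic valuation than \<open>a\<close>.\<close>

lemma gcd_L3_eq_1:
  assumes "b > 0" "even b" "p \<in> {2, 3}" "p ^ e dvd b" "\<not> p ^ e dvd a"
  shows "gcd (L3 a) (L3 b) = 1"
proof -
  let ?D = "gcd (L3 a) (L3 b)"
  have "prime p"
    using assms(3) by auto
  then have "p * gcd a b dvd b"
    using prime_mult_gcd_dvd assms(4,5) by blast
  \<comment> \<open>One factor \<open>p\<close> moves from 6 to the gcd, where \<open>b\<close>
    absorbs it.\<close>
  moreover have "6 * gcd a b = (6 div p) * (p * gcd a b)"
    using assms(3) by auto
  ultimately have "6 * gcd a b dvd (6 div p) * b"
    by (metis dvd_refl mult_dvd_mono)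
  then have one: "[2 ^ ((6 div p) * b) = 1] (mod ?D)"
    by (intro cong_power_eq_1_dvd [OF L3_cong_power_6_gcd [of ?D a b]]) auto
  have minus: "?D dvd 2 ^ (3 * b) + 1"
    using L3_dvd_power_plus_1 [of b] by (metis dvd_trans gcd_dvd2)
  have "?D dvd int p"
    using assms(3)
  proof (elim insertE emptyE)
    assume "p = 2"
    then have "?D dvd 2 ^ (3 * b) - 1"
      using one by (simp add: cong_iff_dvd_diff)
    from dvd_diff [OF minus this] show ?thesis
      by (simp add: \<open>p = 2\<close>)
  next
    assume "p = 3"
    define x where "x = (2 :: int) ^ b"
    have "?D dvd x\<^sup>2 - 1"
      using one \<open>p = 3\<close> by (simp add: cong_iff_dvd_diff x_def mult.commute flip: power_mult)
    moreover have "?D dvd x\<^sup>2 - x + 1"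
      unfolding x_def L3_eq [symmetric] by simp
    \<comment> \<open>A Bezout identity for the two polynomials in \<open>x\<close>, whose resultant
      is 3.\<close>
    moreover have "3 = (x\<^sup>2 - x + 1) * (x + 2) - (x\<^sup>2 - 1) * (x + 1)"
      by (simp add: algebra_simps power2_eq_square)
    ultimately show ?thesis
      unfolding \<open>p = 3\<close> by (metis dvd_diff dvd_mult2 of_nat_numeral)
  qed
  moreover have "coprime (int p) (L3 b)"
    using assms(1,2,3) odd_L3 [of b] not_3_dvd_L3 [of b]
    by (auto intro!: prime_imp_coprime)
  ultimately show ?thesis
    by (metis coprime_common_divisor gcd_dvd2 is_unit_gcd_iff dvd_refl)
qed

theorem theorem4:
  fixes m m1 m2 n n1 n2 t1 t2 :: nat
  assumes "n > 0" and "n1 > 0" and "n2 > 0"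
    and "t1 \<ge> 1" and "t2 \<ge> 1"
    and "odd t1" and "odd t2"
    and "\<not> [t1 = 0] (mod 3)" and "\<not> [t2 = 0] (mod 3)"
  shows "gcd (L3 (3 ^ m * 2 ^ n * t1)) (L3 (3 ^ m * 2 ^ n * t2)) = L3 (3 ^ m * 2 ^ n * gcd t1 t2)
    \<and> (m1 \<noteq> m2 \<or> n1 \<noteq> n2 \<longrightarrow>
         gcd (L3 (3 ^ m1 * 2 ^ n1 * t1)) (L3 (3 ^ m2 * 2 ^ n2 * t2)) = 1)"
proof (intro conjI impI)
  have cop: "coprime t1 2" "coprime t2 2" "coprime t1 3" "coprime t2 3"
    using assms prime_imp_coprime [of 3 t1] prime_imp_coprime [of 3 t2]
    by (auto simp: cong_0_iff coprime_commute)
  then have "coprime t1 (2 * 3)" "coprime t2 (2 * 3)"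
    by (simp_all only: coprime_mult_right_iff)
  then show "gcd (L3 (3 ^ m * 2 ^ n * t1)) (L3 (3 ^ m * 2 ^ n * t2)) = L3 (3 ^ m * 2 ^ n * gcd t1 t2)"
    by (intro gcd_L3_mult) simp_all
next
  assume ne: "m1 \<noteq> m2 \<or> n1 \<noteq> n2"
  \<comment> \<open>The second argument carries the larger power of 3 or of 2; the opposite case
    follows by exchanging the arguments.\<close>
  have *: "gcd (L3 (3 ^ i * 2 ^ j * s)) (L3 (3 ^ i' * 2 ^ j' * s')) = 1"
    if "i < i' \<or> j < j'" "odd s" "\<not> 3 dvd s" "j' > 0" "s' > 0" for i i' j j' s s' :: nat
  proof -
    have "\<not> 3 ^ i' dvd 3 ^ i * 2 ^ j * s" if "i < i'"
    proof
      assume "3 ^ i' dvd 3 ^ i * 2 ^ j * s"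
      \<comment> \<open>A single factor 3 beyond \<open>3 ^ i\<close> is enough: after cancelling,
        it would have to divide \<open>2 ^ j * s\<close>.\<close>
      moreover have "3 ^ i * 3 dvd (3 :: nat) ^ i'"
        using that le_imp_power_dvd [of "Suc i" i' "3 :: nat"] by (simp add: mult.commute)
      ultimately have "3 ^ i * 3 dvd 3 ^ i * (2 ^ j * s)"
        by (metis dvd_trans mult.assoc)
      then have "3 dvd 2 ^ j * s"
        by simp
      then show False
        using \<open>\<not> 3 dvd s\<close> prime_dvd_mult_iff [of 3 "2 ^ j" s] prime_dvd_power [of "3 :: nat" 2 j] by auto
    qed
    moreover have "\<not> 2 ^ j' dvd 3 ^ i * 2 ^ j * s" if "j < j'"
    proof
      assume "2 ^ j' dvd 3 ^ i * 2 ^ j * s"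
      moreover have "2 ^ j * 2 dvd (2 :: nat) ^ j'"
        using that le_imp_power_dvd [of "Suc j" j' "2 :: nat"] by (simp add: mult.commute)
      ultimately have "2 ^ j * 2 dvd 2 ^ j * (3 ^ i * s)"
        by (metis dvd_trans mult.assoc mult.commute)
      then have "2 dvd 3 ^ i * s"
        by simp
      then show False
        using \<open>odd s\<close> by simp
    qed
    ultimately show ?thesis
      using that gcd_L3_eq_1 [of "3 ^ i' * 2 ^ j' * s'" 3 i']
        gcd_L3_eq_1 [of "3 ^ i' * 2 ^ j' * s'" 2 j'] by auto
  qed
  have "\<not> 3 dvd t1" "\<not> 3 dvd t2"
    using assms by (simp_all add: cong_0_iff)
  then show "gcd (L3 (3 ^ m1 * 2 ^ n1 * t1)) (L3 (3 ^ m2 * 2 ^ n2 * t2)) = 1"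
    using ne assms * [of m1 m2 n1 n2 t1 t2] * [of m2 m1 n2 n1 t2 t1]
    by (auto simp: nat_neq_iff coprime_commute)
qed

end
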